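(* Let $\alpha>0$. Suppose that the weighted multigraph $G'$ differs from the weighted multigraph $G$ in a $(k,t)$ edge only, with weight increment $\Delta\varepsilon_{kt}=\varepsilon\neq 0$. Then for every $i,j\in V(G)$, $$q'_{ij}-q_{ij}=\frac{\alpha\,(q_{ik}-q_{it})(q_{jt}-q_{jk})}{\rho_{kt}+\varepsilon^{-1}}.$$
   Context: A weighted multigraph $G$ has finite vertex set $V(G)=\{1,\ldots,n\}$; multiple edges are allowed, loops are not, and all edge weights are strictly positive. Its Laplacian matrix $L=L(G)=(\ell_{ij})$ is given by: for $j\ne i$, $\ell_{ij}$ is minus the sum of the weights of all edges with terminal vertices $i$ and $j$; and $\ell_{ii}=-\sum_{j\neq i}\ell_{ij}$. For a fixed parameter $\alpha>0$, the relative forest accessibility matrix is $Q=(q_{ij})=(I+\alpha L)^{-1}$, and the adjusted forest distance is $\rho_{ij}=\alpha(q_{ii}+q_{jj}-q_{ij}-q_{ji})$. For $k\neq t$, a weighted multigraph $G'$ (on the same vertex set) differs from $G$ in a $(k,t)$ edge only, with $\Delta\varepsilon_{kt}=\varepsilon\neq0$, if $G'$ is obtained from $G$ by increasing the weight of some edge between $k$ and $t$ by $\varepsilon$, or by adding a new edge between $k$ and $t$ with weight $\varepsilon$ (when $\varepsilon>0$), or by removing an edge between $k$ and $t$ with weight $-\varepsilon$ (when $\varepsilon<0$). Unprimed quantities refer to $G$ and primed quantities refer to $G'$, with the same $\alpha$. *)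

theory Defs
  imports "HOL-Analysis.Analysis" "HOL-Library.Multiset"
begin

(* The vertex set is the whole finite type 'n. A multigraph is the finite multiset of its
   edges, each given by its set of terminal vertices and its weight; parallel edges,
   possibly of equal weight, are distinct occurrences in the multiset. *)
type_synonym 'n multigraph = "('n set \<times> real) multiset"

definition weighted_multigraph :: "'n multigraph \<Rightarrow> bool" where
  "weighted_multigraph G \<longleftrightarrow> (\<forall>(e, w) \<in># G. card e = 2 \<and> w > 0)"

definition total_weight :: "'n multigraph \<Rightarrow> 'n \<Rightarrow> 'n \<Rightarrow> real" where
  "total_weight G i j = (\<Sum>(e, w) \<in># filter_mset (\<lambda>(e, w). e = {i, j}) G. w)"

definition laplacian :: "'n::finite multigraph \<Rightarrow> real^'n^'n" where
  "laplacian G = (\<chi> i j. if j \<noteq> i then - total_weight G i j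
                         else - (\<Sum>m \<in> UNIV - {i}. - total_weight G i m))"

(* The matrix inverted here is positive definite for every weighted multigraph when
   \<alpha> > 0, so matrix_inv is the genuine inverse. *)
definition forest_accessibility :: "real \<Rightarrow> 'n::finite multigraph \<Rightarrow> real^'n^'n" where
  "forest_accessibility \<alpha> G = matrix_inv (mat 1 + \<alpha> *\<^sub>R laplacian G)"

definition forest_distance :: "real \<Rightarrow> 'n::finite multigraph \<Rightarrow> 'n \<Rightarrow> 'n \<Rightarrow> real" where
  "forest_distance \<alpha> G i j =
     (let Q = forest_accessibility \<alpha> G in \<alpha> * (Q $ i $ i + Q $ j $ j - Q $ i $ j - Q $ j $ i))"

(* The disjuncts: reweighting, adding, and removing one (k,t) edge. In the first, \<epsilon> may be
   negative; the new weight is positive whenever G' is again a weighted multigraph. *)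
definition differs_in_edge ::
    "'n multigraph \<Rightarrow> 'n multigraph \<Rightarrow> 'n \<Rightarrow> 'n \<Rightarrow> real \<Rightarrow> bool" where
  "differs_in_edge G G' k t \<epsilon> \<longleftrightarrow>
     (\<exists>w. ({k, t}, w) \<in># G \<and> G' = add_mset ({k, t}, w + \<epsilon>) (G - {#({k, t}, w)#})) \<or>
     (\<epsilon> > 0 \<and> G' = add_mset ({k, t}, \<epsilon>) G) \<or>
     (\<epsilon> < 0 \<and> ({k, t}, - \<epsilon>) \<in># G \<and> G' = G - {#({k, t}, - \<epsilon>)#})"

end

theory Submission
  imports Defs
begin

text \<open>
  With u = axis k 1 - axis t 1, the matrix inverted for G' is the one inverted for G plus
  \<alpha> \<epsilon> times the rank-one matrix outer_product u u, so the identity is an instance of the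
  Sherman--Morrison formula. Both matrices are invertible because they are strictly diagonally
  dominant, and the denominator cannot vanish since Q u = (1 + \<epsilon> \<rho>) Q' u and Q u is nonzero.
\<close>

section \<open>Rank-one matrices and rank-one updates of an inverse\<close>

definition outer_product :: "real^'n \<Rightarrow> real^'m \<Rightarrow> real^'m^'n" where
  "outer_product u v = (\<chi> i j. u $ i * v $ j)"

lemma outer_product_mult_vec: "outer_product u v *v x = (v \<bullet> x) *\<^sub>R u"
  by (simp add: outer_product_def vec_eq_iff matrix_vector_mult_def inner_vec_def
      sum_distrib_left sum_distrib_right mult_ac)

lemma outer_product_matrix_mult: "outer_product u v ** B = outer_product u (v v* B)"
  by (simp add: outer_product_def vec_eq_iff matrix_matrix_mult_def vector_matrix_mult_def
      sum_distrib_left mult_ac)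

lemma matrix_mult_outer_product: "B ** outer_product u v = outer_product (B *v u) v"
  by (simp add: outer_product_def vec_eq_iff matrix_matrix_mult_def matrix_vector_mult_def
      sum_distrib_left sum_distrib_right mult_ac)

lemma outer_product_scaleR_left: "outer_product (a *\<^sub>R u) v = a *\<^sub>R outer_product u v"
  by (simp add: outer_product_def vec_eq_iff mult_ac)

lemma matrix_add_rdistrib:
  fixes A B :: "'a::semiring_1^'n^'m"
  shows "(A + B) ** C = A ** C + B ** C"
  by (simp add: vec_eq_iff matrix_matrix_mult_def distrib_right sum.distrib)

lemma matrix_inv_left_right:
  fixes A :: "real^'n^'n"
  assumes "invertible A"
  shows "A ** matrix_inv A = mat 1" "matrix_inv A ** A = mat 1"
  using someI_ex[OF assms[unfolded invertible_def]] unfolding matrix_inv_def by auto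

text \<open>Often \<open>1 + c * s \<noteq> 0\<close> is assumed and invertibility of
  \<open>A'\<close> derived. Here the direction is reversed, because positivity of the edge weights
  already makes both matrices invertible.\<close>

lemma Sherman_Morrison:
  fixes A A' :: "real^'n^'n" and u v :: "real^'n"
  assumes "invertible A" "invertible A'" "u \<noteq> 0"
    and A': "A' = A + c *\<^sub>R outer_product u v"
  defines "s \<equiv> v \<bullet> (matrix_inv A *v u)"
  shows "1 + c * s \<noteq> 0"
    and "matrix_inv A' - matrix_inv A =
           - (c / (1 + c * s)) *\<^sub>R outer_product (matrix_inv A *v u) (v v* matrix_inv A)"
proof -
  let ?N = "matrix_inv A" and ?N' = "matrix_inv A'"
  note N = matrix_inv_left_right[OF \<open>invertible A\<close>]
  note N' = matrix_inv_left_right[OF \<open>invertible A'\<close>]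
  have "A *v (?N *v u) = u" by (simp add: matrix_vector_mul_assoc N)
  \<comment> \<open>The rank-one term maps everything into the span of \<open>u\<close>, and
    \<open>A\<close> sends \<open>?N *v u\<close> to \<open>u\<close> itself, so \<open>A'\<close>
    sends it to a multiple of \<open>u\<close>.\<close>
  then have "A' *v (?N *v u) = (1 + c * s) *\<^sub>R u"
    by (simp add: A' matrix_vector_mult_add_rdistrib scaleR_matrix_vector_assoc[symmetric]
        outer_product_mult_vec s_def scaleR_add_left del: matrix_vector_mul_assoc)
  then have "?N' *v (A' *v (?N *v u)) = (1 + c * s) *\<^sub>R (?N' *v u)"
    by (simp add: matrix_vector_mult_scaleR)
  then have Nu: "?N *v u = (1 + c * s) *\<^sub>R (?N' *v u)"
    by (simp add: matrix_vector_mul_assoc matrix_mul_assoc N')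
  show nz: "1 + c * s \<noteq> 0"
  proof
    assume "1 + c * s = 0"
    then have "A *v (?N *v u) = 0" using Nu by simp
    then show False using \<open>u \<noteq> 0\<close> by (simp add: matrix_vector_mul_assoc N)
  qed
  \<comment> \<open>Expanding \<open>A'\<close> here leaves a correction that contains
    \<open>?N' *v u\<close>; \<open>Nu\<close> then trades it for \<open>?N *v u\<close> at the
    price of dividing by \<open>1 + c * s\<close>.\<close>
  have "?N = ?N' ** (A' ** ?N)" by (simp add: matrix_mul_assoc N')
  also have "A' ** ?N = mat 1 + c *\<^sub>R outer_product u (v v* ?N)"
    by (simp add: A' matrix_add_rdistrib scalar_matrix_assoc[symmetric]
        outer_product_matrix_mult N)
  also have "?N' ** \<dots> = ?N' + c *\<^sub>R outer_product (?N' *v u) (v v* ?N)"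
    by (simp add: matrix_add_ldistrib matrix_scalar_ac matrix_mult_outer_product
        scaleR_matrix_vector_assoc[symmetric] outer_product_scaleR_left)
  finally have "?N' - ?N = - c *\<^sub>R outer_product (?N' *v u) (v v* ?N)"
    by (simp add: algebra_simps)
  then show "?N' - ?N = - (c / (1 + c * s)) *\<^sub>R outer_product (?N *v u) (v v* ?N)"
    using nz by (simp add: Nu outer_product_scaleR_left)
qed

section \<open>Edge weights and the Laplacian when one edge changes\<close>

lemma total_weight_add_mset:
  "total_weight (add_mset (e, w) G) i j = total_weight G i j + (if e = {i, j} then w else 0)"
  by (simp add: total_weight_def)

lemma total_weight_remove1:
  assumes "(e, w) \<in># G"
  shows "total_weight (G - {#(e, w)#}) i j = total_weight G i j - (if e = {i, j} then w else 0)"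
  using total_weight_add_mset[of e w "G - {#(e, w)#}" i j] assms by simp

lemma total_weight_commute: "total_weight G i j = total_weight G j i"
  by (simp add: total_weight_def insert_commute)

lemma total_weight_nonneg:
  assumes "weighted_multigraph G"
  shows "total_weight G i j \<ge> 0"
  using assms
proof (induction G)
  case empty
  then show ?case by (simp add: total_weight_def)
next
  case (add x G)
  then show ?case
    by (cases x) (auto simp: weighted_multigraph_def total_weight_add_mset)
qed

text \<open>Reweighting, adding and removing an edge become indistinguishable at the level of total
  weights, so the case split ends here.\<close>

lemma total_weight_differs_in_edge:
  assumes "differs_in_edge G G' k t \<epsilon>"
  shows "total_weight G' i j = total_weight G i j + (if {k, t} = {i, j} then \<epsilon> else 0)"
  using assms unfolding differs_in_edge_def
  by (elim disjE exE conjE) (simp_all add: total_weight_add_mset total_weight_remove1)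

lemma laplacian_nth_diag: "laplacian G $ i $ i = (\<Sum>m\<in>UNIV - {i}. total_weight G i m)"
  by (simp add: laplacian_def sum_negf)

text \<open>The Laplacian is linear in the edge weights, and \<open>axis k 1 - axis t 1\<close> is
  the signed incidence vector of the edge: its outer square has 1 at the two diagonal places and -1
  at the two off-diagonal ones.\<close>

lemma laplacian_differs_in_edge:
  fixes G G' :: "'n::finite multigraph"
  assumes "differs_in_edge G G' k t \<epsilon>" "k \<noteq> t"
  shows "laplacian G' = laplacian G +
           \<epsilon> *\<^sub>R outer_product (axis k 1 - axis t 1) (axis k 1 - axis t 1)"
proof -
  have jump: "(\<Sum>m\<in>UNIV - {i}. if {k, t} = {i, m} then \<epsilon> else 0) =
          (if i = k \<or> i = t then \<epsilon> else 0)" for i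
  proof -
    \<comment> \<open>Since \<open>k \<noteq> t\<close>, the unordered pair matches in two mutually
      exclusive ways. The test on \<open>m\<close> is put outermost so that each sum collapses to a
      single term.\<close>
    have "(\<Sum>m\<in>UNIV - {i}. if {k, t} = {i, m} then \<epsilon> else 0) =
            (\<Sum>m\<in>UNIV - {i}. (if m = t then if i = k then \<epsilon> else 0 else 0)
                         + (if m = k then if i = t then \<epsilon> else 0 else 0))"
      using assms(2) by (intro sum.cong) (auto simp: doubleton_eq_iff)
    then show ?thesis
      using assms(2) by (auto simp: sum.distrib)
  qed
  let ?u = "axis k 1 - axis t 1 :: real^'n"
  have "laplacian G' $ i $ j = laplacian G $ i $ j + \<epsilon> * (?u $ i * ?u $ j)" for i j
  proof (cases "i = j")
    case True
    then show ?thesis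
      using assms(2)
      by (simp only: laplacian_nth_diag total_weight_differs_in_edge[OF assms(1)] sum.distrib jump)
        (auto simp: axis_def)
  next
    case False
    then show ?thesis
      using assms(2)
      by (auto simp: laplacian_def total_weight_differs_in_edge[OF assms(1)] axis_def
          doubleton_eq_iff)
  qed
  then show ?thesis
    by (simp add: vec_eq_iff outer_product_def)
qed

section \<open>Symmetry and invertibility of the matrix defining
  \<open>forest_accessibility\<close>\<close>

lemma transpose_laplacian: "transpose (laplacian G) = laplacian G"
  by (auto simp: transpose_def laplacian_def vec_eq_iff total_weight_commute)

text \<open>Zero row sums allow each row to be written with differences of entries; at a maximal
  entry of \<open>x\<close> all these terms are nonnegative.\<close>

lemma laplacian_mult_vec:
  "(laplacian G *v x) $ i = (\<Sum>m\<in>UNIV - {i}. total_weight G i m * (x $ i - x $ m))"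
proof -
  have "(laplacian G *v x) $ i = laplacian G $ i $ i * x $ i
          + (\<Sum>m\<in>UNIV - {i}. laplacian G $ i $ m * x $ m)"
    unfolding matrix_vector_mult_def by (simp add: sum.remove[of UNIV i])
  also have "(\<Sum>m\<in>UNIV - {i}. laplacian G $ i $ m * x $ m)
      = (\<Sum>m\<in>UNIV - {i}. - total_weight G i m * x $ m)"
    by (intro sum.cong) (auto simp: laplacian_def)
  finally show ?thesis
    by (simp add: laplacian_nth_diag sum_negf sum_distrib_right right_diff_distrib sum_subtractf)
qed

text \<open>For a square matrix a trivial kernel suffices. A kernel vector satisfies
  \<open>x = - \<alpha> L x\<close>, which excludes a positive maximum and a negative
  minimum.\<close>

lemma invertible_mat_plus_laplacian:
  assumes "\<alpha> > 0" "weighted_multigraph G"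
  shows "invertible (mat 1 + \<alpha> *\<^sub>R laplacian G)"
proof -
  have "x = 0" if x: "(mat 1 + \<alpha> *\<^sub>R laplacian G) *v x = 0" for x
  proof -
    have eq: "x $ i = - \<alpha> * (laplacian G *v x) $ i" for i
      using arg_cong[OF x, of "\<lambda>y. y $ i"]
      by (simp add: matrix_vector_mult_add_rdistrib scaleR_matrix_vector_assoc[symmetric])
    \<comment> \<open>Maximum principle, applied with s = 1 and s = -1 at a maximum of s x.\<close>
    have le0: "s * x $ i \<le> 0" if "\<And>m. s * x $ m \<le> s * x $ i" for i s
    proof -
      have "0 \<le> (\<Sum>m\<in>UNIV - {i}. total_weight G i m * (s * x $ i - s * x $ m))"
        using that total_weight_nonneg[OF assms(2)]
        by (intro sum_nonneg mult_nonneg_nonneg) auto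
      also have "\<dots> = s * (laplacian G *v x) $ i"
        by (simp add: laplacian_mult_vec sum_distrib_left algebra_simps)
      finally have "0 \<le> \<alpha> * (s * (laplacian G *v x) $ i)"
        using assms(1) by (intro mult_nonneg_nonneg[of \<alpha>]) auto
      then show ?thesis
        by (subst eq) (simp add: algebra_simps)
    qed
    have bound: "s * x $ m \<le> 0" for m s
    proof -
      have "Max (range (\<lambda>m. s * x $ m)) \<in> range (\<lambda>m. s * x $ m)"
        by (intro Max_in) auto
      then obtain i where i: "Max (range (\<lambda>m. s * x $ m)) = s * x $ i" by (rule imageE)
      have le: "s * x $ m \<le> s * x $ i" for m
        unfolding i[symmetric] by (intro Max_ge) auto
      show ?thesis using le[of m] le0[OF le] by linarith
    qed
    show "x = 0"
      using bound[of 1] bound[of "-1"] by (auto simp: vec_eq_iff intro: antisym)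
  qed
  then show ?thesis
    using matrix_left_invertible_ker invertible_left_inverse by blast
qed

text \<open>Transposing \<open>A ** matrix_inv A = mat 1\<close> exhibits the transposed inverse as
  a left inverse of \<open>A\<close>, and a left inverse equals the right inverse.\<close>

lemma transpose_matrix_inv:
  fixes A :: "real^'n^'n"
  assumes "invertible A" "transpose A = A"
  shows "transpose (matrix_inv A) = matrix_inv A"
proof -
  note N = matrix_inv_left_right[OF assms(1)]
  have "transpose (matrix_inv A) ** A = transpose (A ** matrix_inv A)"
    by (simp add: matrix_transpose_mul assms(2))
  then have "transpose (matrix_inv A) ** A ** matrix_inv A = matrix_inv A"
    by (simp add: N)
  then show ?thesis
    by (simp add: matrix_mul_assoc[symmetric] N)
qed

text \<open>This lets the row factor \<open>u v* Q\<close> of the rank-one correction be read as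
  \<open>Q *v u\<close>, whose entry at \<open>j\<close> comes from row \<open>j\<close> of
  \<open>Q\<close>.\<close>

lemma forest_accessibility_commute:
  assumes "\<alpha> > 0" "weighted_multigraph G"
  shows "forest_accessibility \<alpha> G $ i $ j = forest_accessibility \<alpha> G $ j $ i"
proof -
  have "transpose (mat 1 + \<alpha> *\<^sub>R laplacian G) = mat 1 + \<alpha> *\<^sub>R laplacian G"
    using transpose_laplacian[of G] by (auto simp: transpose_def vec_eq_iff mat_def)
  then have "transpose (forest_accessibility \<alpha> G) = forest_accessibility \<alpha> G"
    unfolding forest_accessibility_def
    by (intro transpose_matrix_inv invertible_mat_plus_laplacian assms)
  then show ?thesis
    by (metis transpose_def vec_lambda_beta)
qed

section \<open>The change of the forest accessibilities\<close>

theorem proposition3: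
  fixes G G' :: "'n::finite multigraph"
    and \<alpha> \<epsilon> :: real
    and k t i j :: 'n
  assumes "\<alpha> > 0"
    and "weighted_multigraph G"
    and "weighted_multigraph G'"
    and "k \<noteq> t"
    and "\<epsilon> \<noteq> 0"
    and "differs_in_edge G G' k t \<epsilon>"
  defines "Q \<equiv> forest_accessibility \<alpha> G"
    and "Q' \<equiv> forest_accessibility \<alpha> G'"
  shows "Q' $ i $ j - Q $ i $ j =
           \<alpha> * (Q $ i $ k - Q $ i $ t) * (Q $ j $ t - Q $ j $ k)
             / (forest_distance \<alpha> G k t + inverse \<epsilon>)"
proof -
  define u :: "real^'n" where "u = axis k 1 - axis t 1"
  define s where "s = u \<bullet> (Q *v u)"
  define \<rho> where "\<rho> = forest_distance \<alpha> G k t"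
  have "u $ k \<noteq> 0" using \<open>k \<noteq> t\<close> by (simp add: u_def axis_def)
  then have "u \<noteq> 0" by auto
  moreover have "mat 1 + \<alpha> *\<^sub>R laplacian G' =
      mat 1 + \<alpha> *\<^sub>R laplacian G + (\<alpha> * \<epsilon>) *\<^sub>R outer_product u u"
    using laplacian_differs_in_edge[OF assms(6,4)] by (simp add: u_def scaleR_add_right)
  ultimately have nz: "1 + \<alpha> * \<epsilon> * s \<noteq> 0"
    and diff: "Q' - Q = - (\<alpha> * \<epsilon> / (1 + \<alpha> * \<epsilon> * s)) *\<^sub>R outer_product (Q *v u) (u v* Q)"
    unfolding s_def Q_def Q'_def forest_accessibility_def
    using Sherman_Morrison invertible_mat_plus_laplacian[OF assms(1,2)]
      invertible_mat_plus_laplacian[OF assms(1,3)] by blast+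
  have Qu: "(Q *v u) $ l = Q $ l $ k - Q $ l $ t" for l
    by (simp add: u_def matrix_vector_mult_diff_distrib matrix_vector_mult_basis column_def)
  have "u v* Q = transpose Q *v u" by simp
  also have "transpose Q = Q"
    using forest_accessibility_commute[OF assms(1,2)]
    by (simp add: Q_def transpose_def vec_eq_iff)
  finally have uQ: "u v* Q = Q *v u" .
  \<comment> \<open>The forest distance enters as \<open>\<alpha>\<close> times the quadratic form
    of \<open>Q\<close> at the incidence vector \<open>u\<close>, much like an effective
    resistance.\<close>
  have "s = Q $ k $ k + Q $ t $ t - Q $ k $ t - Q $ t $ k"
    unfolding s_def u_def inner_diff_left inner_axis' using Qu[unfolded u_def] by simp
  then have \<rho>: "\<rho> = \<alpha> * s"
    by (simp add: \<rho>_def forest_distance_def Q_def Let_def)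
  have "Q' $ i $ j - Q $ i $ j = (Q' - Q) $ i $ j" by simp
  also have "\<dots> = - (\<alpha> * \<epsilon> / (1 + \<alpha> * \<epsilon> * s)) * ((Q *v u) $ i * (Q *v u) $ j)"
    by (simp add: diff uQ outer_product_def)
  \<comment> \<open>Numerator and denominator are divided by \<open>\<epsilon>\<close>; by
    \<open>nz\<close> the new denominator is nonzero too.\<close>
  also have "\<alpha> * \<epsilon> / (1 + \<alpha> * \<epsilon> * s) = \<alpha> / (\<rho> + inverse \<epsilon>)"
    using \<open>\<epsilon> \<noteq> 0\<close> nz by (simp add: \<rho> field_simps)
  \<comment> \<open>The leading minus sign is absorbed by reversing the difference in the factor for
    \<open>j\<close>.\<close>
  finally show ?thesis
    by (simp add: Qu \<rho>_def algebra_simps add_divide_distrib diff_divide_distrib)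
qed

end
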